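(* Let $(\mathcal{B},\mu)$ be a strictly positive atomless normalized measure algebra. For $n\ge2$ and $F:[0,1]^n\to[0,1]$ define $$\mathcal{E}_n(F)=\sup_{a_1,\ldots,a_n\in\mathcal{B}}\left|\mu\left(\bigwedge_{i=1}^n a_i\right)-F(\mu(a_1),\ldots,\mu(a_n))\right|,$$ and let $P_n(x_1,\ldots,x_n)=\prod_{i=1}^n x_i$. Then for every $n\ge2$, $$\mathcal{E}_n(P_n)=(n-1)\,n^{-n/(n-1)}.$$ Hence, for $n\ge2$, $P_n$ is minimax (that is, $\mathcal{E}_n(P_n)=\inf_F\mathcal{E}_n(F)$ over all $F:[0,1]^n\to[0,1]$) if and only if $n=2$; and as $n\to\infty$, $\mathcal{E}_n(P_n)\to1$ whereas $\inf_F\mathcal{E}_n(F)\to1/2$.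
   Context: A strictly positive atomless normalized measure algebra $(\mathcal{B},\mu)$ is a Dedekind $\sigma$-complete Boolean algebra $\mathcal{B}$ with a countably additive $\mu:\mathcal{B}\to[0,1]$ such that $\mu(1)=1$, $\mu(a)>0$ for every $a\neq 0$, and $\mathcal{B}$ has no atoms. *)

theory Defs
  imports "HOL-Analysis.Analysis" "HOL-Library.Lub_Glb"
begin

(* In a Boolean algebra every set is bounded by bot and top, so the boundedness provisos of
   Dedekind completeness are void. The algebra is the whole type 'a. *)
definition dedekind_sigma_complete :: "'a::boolean_algebra itself \<Rightarrow> bool" where
  "dedekind_sigma_complete _ \<longleftrightarrow>
     (\<forall>A :: 'a set. countable A \<longrightarrow> A \<noteq> {} \<longrightarrow>
        (\<exists>s. isLub UNIV A s) \<and> (\<exists>s. isGlb UNIV A s))"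

definition is_atom :: "'a::boolean_algebra \<Rightarrow> bool" where
  "is_atom a \<longleftrightarrow> a \<noteq> bot \<and> (\<forall>b. b \<le> a \<longrightarrow> b = bot \<or> b = a)"

(* mu bot = 0 is not listed: it is countable additivity for the constant sequence bot. *)
locale atomless_measure_algebra =
  fixes \<mu> :: "'a::boolean_algebra \<Rightarrow> real"
  assumes sigma_complete: "dedekind_sigma_complete TYPE('a)"
    and range: "\<And>a. \<mu> a \<in> {0..1}"
    and countably_additive:
      "\<And>(a :: nat \<Rightarrow> 'a) s. (\<And>i j. i \<noteq> j \<Longrightarrow> inf (a i) (a j) = bot) \<Longrightarrow>
         isLub UNIV (range a) s \<Longrightarrow> (\<lambda>i. \<mu> (a i)) sums \<mu> s"
    and normalized: "\<mu> top = 1"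
    and strictly_positive: "\<And>a. a \<noteq> bot \<Longrightarrow> \<mu> a > 0"
    and atomless: "\<And>a :: 'a. \<not> is_atom a"

(* Points of [0,1]^n are extensional functions on {1..n}. *)
definition cube :: "nat \<Rightarrow> (nat \<Rightarrow> real) set" where
  "cube n = ({1..n} \<rightarrow>\<^sub>E {0..1})"

(* Values of F outside the cube are unconstrained; worst_error never evaluates F there. *)
definition rules :: "nat \<Rightarrow> ((nat \<Rightarrow> real) \<Rightarrow> real) set" where
  "rules n = (cube n \<rightarrow> {0..1})"

(* The supremum is over a set bounded by 1 when F is in rules n; Inf_fin needs n >= 1. *)
definition worst_error ::
    "('a::boolean_algebra \<Rightarrow> real) \<Rightarrow> nat \<Rightarrow> ((nat \<Rightarrow> real) \<Rightarrow> real) \<Rightarrow> real" where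
  "worst_error \<mu> n F =
     (SUP a \<in> {1..n} \<rightarrow>\<^sub>E (UNIV :: 'a set).
        \<bar>\<mu> (\<Sqinter>\<^sub>f\<^sub>i\<^sub>n (a ` {1..n})) - F (\<lambda>i\<in>{1..n}. \<mu> (a i))\<bar>)"

definition product_rule :: "nat \<Rightarrow> (nat \<Rightarrow> real) \<Rightarrow> real" where
  "product_rule n x = (\<Prod>i=1..n. x i)"

definition minimax_error :: "('a::boolean_algebra \<Rightarrow> real) \<Rightarrow> nat \<Rightarrow> real" where
  "minimax_error \<mu> n = (INF F \<in> rules n. worst_error \<mu> n F)"

definition minimax ::
    "('a::boolean_algebra \<Rightarrow> real) \<Rightarrow> nat \<Rightarrow> ((nat \<Rightarrow> real) \<Rightarrow> real) \<Rightarrow> bool" where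
  "minimax \<mu> n F \<longleftrightarrow> F \<in> rules n \<and> worst_error \<mu> n F = minimax_error \<mu> n"

end

theory Submission
  imports Defs "HOL-Real_Asymp.Real_Asymp"
begin

text \<open>
  Given the measures \<open>x\<^sub>i\<close>, the measure of the meet ranges over the Frechet interval from
  \<open>L = max 0 (\<Sum>x\<^sub>i - (n - 1))\<close> to \<open>U = Min x\<^sub>i\<close>. The extreme cases used are all \<open>a\<^sub>i\<close> equal, and the
  complements of \<open>n\<close> disjoint elements of measure \<open>1/n\<close>. For the product rule the largest
  excess \<open>U - \<Prod>x\<^sub>i\<close> is \<open>max (t - t^n)\<close>, attained at \<open>n t^(n-1) = 1\<close>; by AM-GM the deficit \<open>\<Prod>x\<^sub>i - L\<close>
  is at most \<open>(1 - 1/n)^n\<close>, which is no larger. The best rule is the midpoint of the interval, with error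
  \<open>max (U - L) / 2 = (n - 1) / (2n)\<close>. Comparing the two values, equality means \<open>n = 2^(n-1)\<close>.
\<close>

section \<open>Real inequalities around the stationary point of \<open>t - t^n\<close>\<close>

definition product_critical :: "nat \<Rightarrow> real" where
  "product_critical n = real n powr (- (1 / (real n - 1)))"

lemma product_critical_pos:
  assumes "n \<ge> 2"
  shows "product_critical n > 0"
  using assms by (simp add: product_critical_def)

lemma product_critical_le_1:
  assumes "n \<ge> 2"
  shows "product_critical n \<le> 1"
proof -
  have "real n powr (- (1 / (real n - 1))) \<le> real n powr 0"
    using assms by (intro powr_mono) auto
  then show ?thesis using assms by (simp add: product_critical_def)
qed

text \<open>This is the vanishing of the derivative \<open>1 - n * t^(n - 1)\<close> of
  \<open>t - t^n\<close>; the estimates below use the critical point through this equation.\<close>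

lemma product_critical_power:
  assumes "n \<ge> 2"
  shows "product_critical n ^ (n - 1) = 1 / real n"
proof -
  have "product_critical n ^ (n - 1) = real n powr (- (1 / (real n - 1)) * real (n - 1))"
    using assms by (simp add: product_critical_def powr_realpow [symmetric] powr_powr)
  also have "- (1 / (real n - 1)) * real (n - 1) = -1"
    using assms by (simp add: of_nat_diff)
  finally show ?thesis
    using assms by (simp add: powr_minus_divide)
qed

text \<open>Links the closed form of the theorem to the form in which errors are computed: the
  exponent splits as \<open>- n / (n - 1) = - 1 / (n - 1) - 1\<close>.\<close>

lemma product_error_eq:
  assumes "n \<ge> 2"
  shows "(real n - 1) * real n powr (- (real n / (real n - 1)))
       = (real n - 1) / real n * product_critical n"
proof -
  have eq: "- (real n / (real n - 1)) = - (1 / (real n - 1)) + - 1"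
    using assms by (simp add: field_simps)
  have "real n powr (- (real n / (real n - 1))) = product_critical n * (1 / real n)"
    unfolding eq powr_add product_critical_def using assms by (simp add: powr_minus_divide)
  then show ?thesis by simp
qed

lemma product_critical_gap:
  assumes "n \<ge> 2"
  shows "product_critical n - product_critical n ^ n = (real n - 1) / real n * product_critical n"
proof -
  have "product_critical n ^ n = product_critical n * product_critical n ^ (n - 1)"
    using assms by (simp flip: power_Suc)
  also have "\<dots> = product_critical n * (1 / real n)"
    by (simp only: product_critical_power [OF assms])
  finally show ?thesis
    using assms by (simp add: field_simps)
qed

lemma diff_power_le_critical:
  fixes t :: real
  assumes "n \<ge> 2" "t \<ge> 0"
  shows "t - t ^ n \<le> (real n - 1) / real n * product_critical n"
proof -
  let ?c = "product_critical n"
  have c: "?c > 0" and cn: "?c ^ n = ?c * (1 / real n)"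
    using assms product_critical_pos product_critical_power [of n]
    by (auto simp flip: power_Suc simp: power_eq_if)
  \<comment> \<open>The graph of the n-th power lies above its tangent at the critical point, of slope 1.\<close>
  have "1 + real n * (t / ?c - 1) \<le> (1 + (t / ?c - 1)) ^ n"
    using c assms by (intro Bernoulli_inequality) simp
  then have "?c ^ n * (1 + real n * (t / ?c - 1)) \<le> t ^ n"
    using c by (simp add: power_divide field_simps)
  moreover have "?c ^ n * (1 + real n * (t / ?c - 1)) = ?c ^ n + t - ?c"
    unfolding cn using c assms by (simp add: field_simps)
  ultimately show ?thesis
    using product_critical_gap [OF assms(1)] by linarith
qed

text \<open>With \<open>m = n - 1\<close> and \<open>q = m / n\<close>, cancelling one
  \<open>q\<close> and raising to the power \<open>m\<close> leaves
  \<open>q^(m * m) \<le> 1 / n\<close>. As \<open>1 / q = 1 + 1 / m\<close>, this is Bernoulli's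
  inequality with exponent \<open>m * m\<close>.\<close>

lemma equal_coords_power_le_critical:
  assumes "n \<ge> 2"
  shows "((real n - 1) / real n) ^ n \<le> (real n - 1) / real n * product_critical n"
proof -
  obtain m where n: "n = Suc m" and m: "m \<ge> 1"
    using assms by (cases n) auto
  let ?q = "(real n - 1) / real n"
  have q: "?q > 0" using n m by simp
  have bernoulli: "1 + real (m * m) * (1 / real m) \<le> (1 + 1 / real m) ^ (m * m)"
    by (intro Bernoulli_inequality) (simp add: order_trans [of _ 0])
  have eqs: "1 + 1 / real m = inverse ?q" "1 + real (m * m) * (1 / real m) = real n"
    using n m by (simp_all add: field_simps)
  have "real n \<le> inverse ?q ^ (m * m)" using bernoulli unfolding eqs .
  then have "real n \<le> inverse (?q ^ (m * m))" by (simp only: power_inverse)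
  then have "?q ^ (m * m) \<le> 1 / real n"
    using q n by (simp add: field_simps)
  then have "(?q ^ m) ^ m \<le> product_critical n ^ m"
    using product_critical_power [OF assms] n by (simp add: power_mult)
  \<comment> \<open>\<open>power_le_imp_le_base\<close> expects a successor as exponent.\<close>
  then have "(?q ^ m) ^ Suc (m - 1) \<le> product_critical n ^ Suc (m - 1)"
    using m by simp
  then have "?q ^ m \<le> product_critical n"
    by (rule power_le_imp_le_base) (simp add: product_critical_pos [OF assms] less_imp_le)
  then show ?thesis
    using mult_left_mono [of "?q ^ m" "product_critical n" ?q] q unfolding n power_Suc by simp
qed

text \<open>The derivative of \<open>t^n\<close> is at most \<open>n\<close> on the unit interval;
  the induction replaces the mean value theorem.\<close>

lemma power_diff_le_mult:
  fixes x y :: real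
  assumes "0 \<le> x" "x \<le> y" "y \<le> 1"
  shows "y ^ n - x ^ n \<le> real n * (y - x)"
proof (induction n)
  case (Suc n)
  have "y ^ Suc n - x ^ Suc n = y * (y ^ n - x ^ n) + x ^ n * (y - x)"
    by (simp add: algebra_simps)
  also have "\<dots> \<le> 1 * (y ^ n - x ^ n) + 1 * (y - x)"
    using assms power_mono [of x y n] by (intro add_mono mult_right_mono) (auto intro: power_le_one)
  finally show ?case
    using Suc by (simp add: algebra_simps)
qed simp

lemma prod_le_mean_power:
  fixes x :: "'b \<Rightarrow> real"
  assumes "finite S" "S \<noteq> {}" "\<And>i. i \<in> S \<Longrightarrow> x i \<ge> 0"
  shows "prod x S \<le> (sum x S / real (card S)) ^ card S"
proof -
  have c: "card S > 0" using assms by (simp add: card_gt_0_iff)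
  have "prod x S powr (1 / real (card S)) \<le> sum x S / real (card S)"
    using arith_geom_mean [of S x] assms by (simp add: sum_divide_distrib)
  then have "(prod x S powr (1 / real (card S))) ^ card S \<le> (sum x S / real (card S)) ^ card S"
    by (intro power_mono) auto
  moreover have "(prod x S powr (1 / real (card S))) ^ card S = prod x S"
  \<comment> \<open>Turning \<open>powr\<close> into a natural power needs a positive base, so a
    zero product is treated apart.\<close>
  proof (cases "prod x S = 0")
    case False
    then have "prod x S > 0"
      using assms prod_nonneg [of S x] by (simp add: less_le)
    then show ?thesis
      using c by (simp add: powr_powr flip: powr_realpow)
  qed (use c in simp)
  ultimately show ?thesis by simp
qed

text \<open>By AM-GM only the mean \<open>s\<close> matters. The lower bound becomes positive at
  \<open>s = (n - 1) / n\<close> and then grows with slope \<open>n\<close>, at least as fast as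
  \<open>s^n\<close>, so the majorant of the deficit peaks at that corner.\<close>

lemma prod_minus_lower_le_critical:
  fixes x :: "nat \<Rightarrow> real"
  assumes "n \<ge> 2" "\<And>i. i \<in> {1..n} \<Longrightarrow> 0 \<le> x i \<and> x i \<le> 1"
  shows "prod x {1..n} - max 0 (sum x {1..n} - (real n - 1))
       \<le> (real n - 1) / real n * product_critical n"
proof -
  let ?s = "sum x {1..n} / real n" and ?q = "(real n - 1) / real n"
  have s: "0 \<le> ?s" using assms by (auto intro!: sum_nonneg divide_nonneg_nonneg)
  have "sum x {1..n} \<le> real n"
    using assms sum_bounded_above [of "{1..n}" x 1] by auto
  then have s1: "?s \<le> 1" using assms by simp
  have amgm: "prod x {1..n} \<le> ?s ^ n"
    using prod_le_mean_power [of "{1..n}" x] assms by simp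
  have "prod x {1..n} - max 0 (sum x {1..n} - (real n - 1)) \<le> ?q ^ n"
  proof (cases "?s \<le> ?q")
    case True
    then have "?s ^ n \<le> ?q ^ n" using s by (intro power_mono)
    then show ?thesis using amgm by linarith
  next
    case False
    then have "?s ^ n - ?q ^ n \<le> real n * (?s - ?q)"
      using assms s1 by (intro power_diff_le_mult) auto
    also have "\<dots> = sum x {1..n} - (real n - 1)"
      using assms by (simp add: field_simps)
    finally show ?thesis using amgm by linarith
  qed
  with equal_coords_power_le_critical [OF assms(1)] show ?thesis by linarith
qed

section \<open>Finite additivity and the Frechet bounds\<close>

context atomless_measure_algebra
begin

lemma measure_nonneg: "\<mu> a \<ge> 0" and measure_le_1: "\<mu> a \<le> 1"
  using range [of a] by auto

lemma measure_bot: "\<mu> bot = 0"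
proof -
  have "isLub UNIV (range (\<lambda>i::nat. bot::'a)) bot"
    by (auto simp: isLub_def leastP_def isUb_def setle_def setge_def)
  then have "(\<lambda>i::nat. \<mu> bot) sums \<mu> bot"
    by (intro countably_additive) auto
  then have "summable (\<lambda>i::nat. \<mu> bot)"
    by (rule sums_summable)
  then show ?thesis by (simp add: summable_const_iff)
qed

lemma measure_sup_disjoint:
  assumes "inf a b = bot"
  shows "\<mu> (sup a b) = \<mu> a + \<mu> b"
proof -
  \<comment> \<open>Padding with \<open>bot\<close>, of measure zero, turns two elements into a
    disjoint sequence with the same supremum.\<close>
  let ?f = "\<lambda>i::nat. if i = 0 then a else if i = 1 then b else bot"
  have "isLub UNIV (range ?f) (sup a b)"
  proof -
    have "range ?f = {a, b, bot}"
      by (auto simp: image_iff split: if_splits intro: exI [of _ "0::nat"] exI [of _ "1::nat"] exI [of _ "2::nat"])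
    then show ?thesis
      by (auto simp: isLub_def leastP_def isUb_def setle_def setge_def)
  qed
  then have "(\<lambda>i. \<mu> (?f i)) sums \<mu> (sup a b)"
    using assms by (intro countably_additive) (auto simp: inf_commute)
  moreover have "(\<lambda>i. \<mu> (?f i)) sums (\<Sum>i\<in>{0, 1}. \<mu> (?f i))"
    by (rule sums_finite) (auto simp: measure_bot)
  ultimately have "\<mu> (sup a b) = (\<Sum>i\<in>{0, 1}. \<mu> (?f i))"
    by (rule sums_unique2)
  then show ?thesis by simp
qed

lemma measure_split: "\<mu> a = \<mu> (inf a b) + \<mu> (inf a (- b))"
proof -
  have "sup (inf a b) (inf a (- b)) = a"
    by (simp flip: inf_sup_distrib1)
  moreover have "inf (inf a b) (inf a (- b)) = bot"
    by (metis inf_compl_bot inf_assoc inf_left_commute inf_bot_right)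
  ultimately show ?thesis
    using measure_sup_disjoint [of "inf a b" "inf a (- b)"] by simp
qed

lemma measure_mono:
  assumes "a \<le> b"
  shows "\<mu> a \<le> \<mu> b"
proof -
  have "inf b a = a" using assms by (simp add: inf_absorb2)
  then show ?thesis using measure_split [of b a] measure_nonneg [of "inf b (- a)"] by simp
qed

lemma measure_diff:
  assumes "a \<le> b"
  shows "\<mu> (inf b (- a)) = \<mu> b - \<mu> a"
proof -
  have "inf b a = a" using assms by (simp add: inf_absorb2)
  then show ?thesis using measure_split [of b a] by simp
qed

lemma measure_compl: "\<mu> (- a) = 1 - \<mu> a"
  using measure_diff [of a top] normalized by simp

lemma measure_inf_ge: "\<mu> a + \<mu> b - 1 \<le> \<mu> (inf a b)"
proof -
  have "\<mu> (inf a (- b)) \<le> \<mu> (- b)" by (intro measure_mono) simp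
  then show ?thesis using measure_split [of a b] measure_compl [of b] by simp
qed

text \<open>Iterates \<open>measure_inf_ge\<close>: each of the \<open>card I - 1\<close> binary
  meets contributes one \<open>- 1\<close>.\<close>

lemma measure_Inf_fin_ge:
  assumes "finite I" "I \<noteq> {}"
  shows "(\<Sum>i\<in>I. \<mu> (a i)) - (real (card I) - 1) \<le> \<mu> (\<Sqinter>\<^sub>f\<^sub>i\<^sub>n (a ` I))"
  using assms
proof (induction I rule: finite_ne_induct)
  case (insert i I)
  then have "\<Sqinter>\<^sub>f\<^sub>i\<^sub>n (a ` insert i I) = inf (a i) (\<Sqinter>\<^sub>f\<^sub>i\<^sub>n (a ` I))" by simp
  then show ?case
    using insert measure_inf_ge [of "a i" "\<Sqinter>\<^sub>f\<^sub>i\<^sub>n (a ` I)"] by simp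
qed simp

lemma measure_Inf_fin_le:
  assumes "finite I" "i \<in> I"
  shows "\<mu> (\<Sqinter>\<^sub>f\<^sub>i\<^sub>n (a ` I)) \<le> \<mu> (a i)"
  using assms by (intro measure_mono Inf_fin.coboundedI) auto

section \<open>Elements of prescribed measure\<close>

lemma halving:
  assumes "b \<noteq> bot"
  shows "\<exists>c\<le>b. c \<noteq> bot \<and> \<mu> c \<le> \<mu> b / 2"
proof -
  from atomless [of b] assms obtain c where c: "c \<le> b" "c \<noteq> bot" "c \<noteq> b"
    by (auto simp: is_atom_def)
  have "inf b (- c) \<noteq> bot"
    using c by (metis inf_shunt double_compl antisym)
  \<comment> \<open>The two nonzero pieces add up to \<open>\<mu> b\<close>, so the lighter one has
    at most half.\<close>
  moreover have "\<mu> c \<le> \<mu> b / 2 \<or> \<mu> (inf b (- c)) \<le> \<mu> b / 2"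
    using measure_diff [OF c(1)] by linarith
  ultimately show ?thesis using c by (meson inf_le1)
qed

text \<open>Repeated halving. It supplies a nonzero piece that still fits under a target measure not
  yet reached.\<close>

lemma small_element:
  assumes "b \<noteq> bot" "\<epsilon> > 0"
  shows "\<exists>c\<le>b. c \<noteq> bot \<and> \<mu> c < \<epsilon>"
proof -
  have "\<exists>c\<le>b. c \<noteq> bot \<and> \<mu> c \<le> \<mu> b / 2 ^ k" for k
  proof (induction k)
    case (Suc k)
    then obtain c where c: "c \<le> b" "c \<noteq> bot" "\<mu> c \<le> \<mu> b / 2 ^ k" by blast
    with halving [of c] obtain d where "d \<le> c" "d \<noteq> bot" "\<mu> d \<le> \<mu> c / 2" by blast
    with c show ?case by (intro exI [of _ d]) auto
  qed (use assms in auto)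
  moreover obtain k where "(1 / 2) ^ k < \<epsilon>"
    using real_arch_pow_inv [of \<epsilon> "1/2"] assms by auto
  moreover have "\<mu> b / 2 ^ k \<le> (1 / 2) ^ k"
    using measure_le_1 [of b] by (simp add: power_one_over divide_right_mono)
  ultimately show ?thesis by (meson le_less_trans)
qed

text \<open>A greedy exhaustion: each step adds a disjoint piece of at least half the largest admissible
  measure, so that any admissible piece left over at the limit has measure zero.\<close>

lemma exists_measure_eq:
  assumes "0 \<le> t" "t \<le> \<mu> b"
  shows "\<exists>a\<le>b. \<mu> a = t"
proof -
  define A where "A c = {d. d \<le> b \<and> inf c d = bot \<and> \<mu> c + \<mu> d \<le> t}" for c
  have step: "\<exists>d. d \<in> A c \<and> (\<forall>e\<in>A c. \<mu> e \<le> 2 * \<mu> d)" if "\<mu> c \<le> t" for c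
  proof -
    let ?s = "SUP e\<in>A c. \<mu> e"
    have bot: "bot \<in> A c" using that by (simp add: A_def measure_bot)
    have bdd: "bdd_above (\<mu> ` A c)" by (rule bdd_aboveI2 [of _ _ 1]) (rule measure_le_1)
    have le: "\<mu> e \<le> ?s" if "e \<in> A c" for e
      using that bdd by (rule cSUP_upper)
    show ?thesis
    \<comment> \<open>With supremum zero nothing exceeds half of it strictly, and \<open>bot\<close>
      is the choice.\<close>
    proof (cases "?s \<le> 0")
      case True
      then show ?thesis using bot le by (intro exI [of _ bot]) (auto simp: measure_bot intro: order_trans)
    next
      case False
      then have "?s / 2 < ?s" by simp
      then obtain d where "d \<in> A c" "?s / 2 < \<mu> d"
        using less_cSUP_iff [of "A c" \<mu> "?s / 2"] bot bdd by auto
      moreover have "\<mu> e \<le> 2 * \<mu> d" if "e \<in> A c" for e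
        using le [OF that] \<open>?s / 2 < \<mu> d\<close> by linarith
      ultimately show ?thesis by blast
    qed
  qed
  then have "\<forall>c. \<exists>d. \<mu> c \<le> t \<longrightarrow> d \<in> A c \<and> (\<forall>e\<in>A c. \<mu> e \<le> 2 * \<mu> d)"
    by blast
  then obtain g where g: "\<And>c. \<mu> c \<le> t \<Longrightarrow> g c \<in> A c"
      "\<And>c e. \<mu> c \<le> t \<Longrightarrow> e \<in> A c \<Longrightarrow> \<mu> e \<le> 2 * \<mu> (g c)"
    unfolding choice_iff by blast
  define c where "c = rec_nat bot (\<lambda>_ x. sup x (g x))"
  define d where "d k = g (c k)" for k
  have c0: "c 0 = bot" and cSuc: "c (Suc k) = sup (c k) (d k)" for k
    by (simp_all add: c_def d_def)
  have inv: "c k \<le> b \<and> \<mu> (c k) \<le> t \<and> \<mu> (c k) = (\<Sum>i<k. \<mu> (d i))" for k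
  proof (induction k)
    case 0
    then show ?case using assms by (simp add: c0 measure_bot)
  next
    case (Suc k)
    then have "d k \<in> A (c k)" using g(1) by (simp add: d_def)
    then show ?case using Suc by (auto simp: A_def cSuc measure_sup_disjoint)
  qed
  have dA: "d k \<in> A (c k)" and dmax: "\<And>e. e \<in> A (c k) \<Longrightarrow> \<mu> e \<le> 2 * \<mu> (d k)" for k
    using g inv by (auto simp: d_def)
  have mono: "c i \<le> c j" if "i \<le> j" for i j
    using that by (rule lift_Suc_mono_le [rotated]) (simp add: cSuc)
  have disj: "inf (d i) (d j) = bot" if "i < j" for i j
  proof -
    have "d i \<le> c j" using mono [of "Suc i" j] that by (simp add: cSuc)
    then have "inf (d i) (d j) \<le> inf (c j) (d j)" by (intro inf_mono) auto
    also have "\<dots> = bot" using dA [of j] by (simp add: A_def)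
    finally show ?thesis by (simp only: bot_unique)
  qed
  then have disj': "inf (d i) (d j) = bot" if "i \<noteq> j" for i j
    using that by (metis inf_commute linorder_neqE_nat)
  have "countable (range d)" "range d \<noteq> {}" by auto
  then obtain s where s: "isLub UNIV (range d) s"
    using sigma_complete unfolding dedekind_sigma_complete_def
    by blast
  have sums: "(\<lambda>i. \<mu> (d i)) sums \<mu> s"
    using disj' s by (rule countably_additive)
  have d_le: "d i \<le> s" for i using s by (rule isLubD2) simp
  have "s \<le> b"
    using s by (rule isLub_le_isUb) (use dA in \<open>auto simp: isUb_def setle_def A_def\<close>)
  have c_le: "c k \<le> s" for k
    by (induction k) (simp_all add: c0 cSuc d_le)
  have "(\<Sum>i<k. \<mu> (d i)) \<le> t" for k
    using inv [of k] by argo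
  then have "\<mu> s \<le> t"
    using sums unfolding sums_def by (intro LIMSEQ_le_const2) blast+
  \<comment> \<open>The chosen pieces shrink to zero, and by \<open>dmax\<close> they bound, up to a
    factor 2, every piece admissible at all stages.\<close>
  have d0: "(\<lambda>k. \<mu> (d k)) \<longlonglongrightarrow> 0"
    using sums by (intro summable_LIMSEQ_zero sums_summable)
  have "\<mu> s = t"
  proof (rule ccontr)
    assume "\<mu> s \<noteq> t"
    with \<open>\<mu> s \<le> t\<close> have lt: "\<mu> s < t" by simp
    then have "\<mu> (inf b (- s)) > 0" using measure_diff [OF \<open>s \<le> b\<close>] assms by simp
    then have "inf b (- s) \<noteq> bot" by (metis measure_bot less_irrefl)
    from small_element [OF this, of "t - \<mu> s"] lt
    obtain e where e: "e \<le> inf b (- s)" "e \<noteq> bot" "\<mu> e < t - \<mu> s" by auto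
    \<comment> \<open>\<open>e\<close> is disjoint from \<open>s\<close> and fits below
      \<open>t\<close> even on top of \<open>s\<close>; since \<open>c k \<le> s\<close>, it was
      admissible at every stage.\<close>
    have "e \<in> A (c k)" for k
    proof -
      have "inf (c k) e \<le> inf s (- s)" using c_le e by (intro inf_mono) auto
      moreover have "\<mu> (c k) \<le> \<mu> s" using c_le by (rule measure_mono)
      ultimately show ?thesis using e by (auto simp: A_def bot_unique)
    qed
    then have "\<mu> e \<le> 2 * \<mu> (d k)" for k using dmax by blast
    moreover have "(\<lambda>k. 2 * \<mu> (d k)) \<longlonglongrightarrow> 0" using tendsto_mult_right_zero [OF d0] by simp
    ultimately have "\<mu> e \<le> 0" by (intro LIMSEQ_le_const) blast+
    then show False using strictly_positive [OF e(2)] by simp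
  qed
  with \<open>s \<le> b\<close> show ?thesis by blast
qed

text \<open>Each new element is the complement of a piece of measure \<open>t\<close> carved out of
  the current meet, so the meet loses exactly \<open>t\<close>. Keeping \<open>t\<close> independent
  of \<open>n\<close> lets the induction run; it is applied with \<open>t = 1 / n\<close>.\<close>

lemma frechet_lower_attained:
  assumes "n \<ge> 1" "0 \<le> t" "real n * t \<le> 1"
  shows "\<exists>a. (\<forall>i\<in>{1..n}. \<mu> (a i) = 1 - t) \<and> \<mu> (\<Sqinter>\<^sub>f\<^sub>i\<^sub>n (a ` {1..n})) = 1 - real n * t"
  using assms
proof (induction n rule: nat_induct_at_least)
  case base
  then obtain b where "\<mu> b = 1 - t"
    using exists_measure_eq [of "1 - t" top] normalized by auto
  then show ?case by (intro exI [of _ "\<lambda>_. b"]) simp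
next
  case (Suc n)
  then have "real n * t \<le> 1" by (simp add: algebra_simps)
  with Suc obtain a where a: "\<And>i. i \<in> {1..n} \<Longrightarrow> \<mu> (a i) = 1 - t"
    "\<mu> (\<Sqinter>\<^sub>f\<^sub>i\<^sub>n (a ` {1..n})) = 1 - real n * t" by blast
  let ?m = "\<Sqinter>\<^sub>f\<^sub>i\<^sub>n (a ` {1..n})"
  \<comment> \<open>There is room for \<open>p\<close>: the meet has measure
    \<open>1 - n * t\<close>, at least \<open>t\<close> because
    \<open>(n + 1) * t \<le> 1\<close>.\<close>
  obtain p where p: "p \<le> ?m" "\<mu> p = t"
    using exists_measure_eq [of t ?m] a(2) Suc.prems by (auto simp: algebra_simps)
  let ?a = "a(Suc n := - p)"
  have "?a ` {1..Suc n} = insert (- p) (a ` {1..n})"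
    by (auto simp: atLeastAtMostSuc_conv)
  then have "\<Sqinter>\<^sub>f\<^sub>i\<^sub>n (?a ` {1..Suc n}) = inf ?m (- p)"
    using Suc.hyps by (simp add: inf_commute)
  then have "\<mu> (\<Sqinter>\<^sub>f\<^sub>i\<^sub>n (?a ` {1..Suc n})) = 1 - real (Suc n) * t"
    using measure_diff [OF p(1)] a(2) p(2) by (simp add: algebra_simps)
  moreover have "\<mu> (?a i) = 1 - t" if "i \<in> {1..Suc n}" for i
    using that a(1) measure_compl [of p] p(2) by (auto simp: le_Suc_eq)
  ultimately show ?case by (intro exI [of _ ?a]) blast
qed

section \<open>The worst error, and its value for the product rule\<close>

lemma measures_in_cube: "(\<lambda>i\<in>{1..n}. \<mu> (a i)) \<in> cube n"
  using measure_nonneg measure_le_1 by (auto simp: cube_def)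

lemma worst_error_le:
  assumes "\<And>a. \<bar>\<mu> (\<Sqinter>\<^sub>f\<^sub>i\<^sub>n (a ` {1..n})) - F (\<lambda>i\<in>{1..n}. \<mu> (a i))\<bar> \<le> c"
  shows "worst_error \<mu> n F \<le> c"
  unfolding worst_error_def by (rule cSUP_least) (use assms in \<open>auto simp: PiE_eq_empty_iff\<close>)

lemma error_le_worst_error:
  assumes "F \<in> rules n"
  shows "\<bar>\<mu> (\<Sqinter>\<^sub>f\<^sub>i\<^sub>n (a ` {1..n})) - F (\<lambda>i\<in>{1..n}. \<mu> (a i))\<bar> \<le> worst_error \<mu> n F"
proof -
  let ?e = "\<lambda>a. \<bar>\<mu> (\<Sqinter>\<^sub>f\<^sub>i\<^sub>n (a ` {1..n})) - F (\<lambda>i\<in>{1..n}. \<mu> (a i))\<bar>"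
  have "?e b \<le> 1" for b
  proof -
    have "F (\<lambda>i\<in>{1..n}. \<mu> (b i)) \<in> {0..1}"
      using assms measures_in_cube by (auto simp: rules_def)
    then show ?thesis
      using measure_nonneg [of "\<Sqinter>\<^sub>f\<^sub>i\<^sub>n (b ` {1..n})"] measure_le_1 [of "\<Sqinter>\<^sub>f\<^sub>i\<^sub>n (b ` {1..n})"]
      by (auto simp: abs_le_iff)
  qed
  then have "bdd_above (?e ` ({1..n} \<rightarrow>\<^sub>E UNIV))" by (intro bdd_aboveI2)
  \<comment> \<open>The supremum runs over extensional tuples only; restricting \<open>a\<close>
    changes neither the meet nor the measures.\<close>
  then have "?e (restrict a {1..n}) \<le> worst_error \<mu> n F"
    unfolding worst_error_def by (intro cSUP_upper) auto
  moreover have "restrict a {1..n} ` {1..n} = a ` {1..n}" by auto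
  moreover have "(\<lambda>i\<in>{1..n}. \<mu> (restrict a {1..n} i)) = (\<lambda>i\<in>{1..n}. \<mu> (a i))" by auto
  ultimately show ?thesis by simp
qed

lemma product_rule_in_rules: "product_rule n \<in> rules n"
  by (auto simp: rules_def cube_def product_rule_def PiE_iff intro!: prod_nonneg prod_le_1)

lemma worst_error_product_rule:
  assumes "n \<ge> 2"
  shows "worst_error \<mu> n (product_rule n) = (real n - 1) / real n * product_critical n"
proof (rule antisym)
  show "worst_error \<mu> n (product_rule n) \<le> (real n - 1) / real n * product_critical n"
  proof (rule worst_error_le)
    fix a :: "nat \<Rightarrow> 'a"
    let ?m = "\<mu> (\<Sqinter>\<^sub>f\<^sub>i\<^sub>n (a ` {1..n}))" and ?P = "\<Prod>i=1..n. \<mu> (a i)"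
    \<comment> \<open>Every factor is at least the measure \<open>?m\<close> of the meet, which
      reduces the excess to the one-variable function \<open>t - t^n\<close>.\<close>
    have "?m ^ n = (\<Prod>i=1..n. ?m)" by simp
    also have "\<dots> \<le> ?P"
      by (intro prod_mono) (auto simp: measure_nonneg intro: measure_Inf_fin_le)
    finally have "?m - ?P \<le> ?m - ?m ^ n" by simp
    also have "\<dots> \<le> (real n - 1) / real n * product_critical n"
      using assms measure_nonneg by (rule diff_power_le_critical)
    finally have "?m - ?P \<le> (real n - 1) / real n * product_critical n" .
    moreover have "max 0 ((\<Sum>i=1..n. \<mu> (a i)) - (real n - 1)) \<le> ?m"
      using measure_Inf_fin_ge [of "{1..n}" a] assms by (simp add: measure_nonneg)
    moreover have "?P - max 0 ((\<Sum>i=1..n. \<mu> (a i)) - (real n - 1))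
        \<le> (real n - 1) / real n * product_critical n"
      by (rule prod_minus_lower_le_critical) (auto simp: assms measure_nonneg measure_le_1)
    ultimately show "\<bar>?m - product_rule n (\<lambda>i\<in>{1..n}. \<mu> (a i))\<bar>
        \<le> (real n - 1) / real n * product_critical n"
      unfolding product_rule_def by simp linarith
  qed
next
  obtain b where b: "\<mu> b = product_critical n"
    using exists_measure_eq [of "product_critical n" top] normalized
      product_critical_pos [OF assms] product_critical_le_1 [OF assms] by auto
  have "(\<lambda>_. b) ` {1..n} = {b}" using assms by (simp add: image_constant_conv)
  then have "\<bar>product_critical n - product_critical n ^ n\<bar> \<le> worst_error \<mu> n (product_rule n)"
    using error_le_worst_error [OF product_rule_in_rules, of "\<lambda>_. b" n] b
    by (simp add: product_rule_def)
  then show "(real n - 1) / real n * product_critical n \<le> worst_error \<mu> n (product_rule n)"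
    unfolding product_critical_gap [OF assms] by (rule abs_le_D1)
qed

section \<open>The minimax error\<close>

lemma worst_error_ge:
  assumes "n \<ge> 1" "F \<in> rules n"
  shows "(real n - 1) / (2 * real n) \<le> worst_error \<mu> n F"
proof -
  let ?q = "1 - 1 / real n"
  have "\<exists>a. (\<forall>i\<in>{1..n}. \<mu> (a i) = ?q) \<and> \<mu> (\<Sqinter>\<^sub>f\<^sub>i\<^sub>n (a ` {1..n})) = 0"
    using frechet_lower_attained [of n "1 / real n"] assms by simp
  then obtain a where a: "\<And>i. i \<in> {1..n} \<Longrightarrow> \<mu> (a i) = ?q" "\<mu> (\<Sqinter>\<^sub>f\<^sub>i\<^sub>n (a ` {1..n})) = 0"
    by blast
  obtain b where b: "\<mu> b = ?q"
    using exists_measure_eq [of ?q top] normalized assms by auto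
  have "(\<lambda>_. b) ` {1..n} = {b}" using assms by (simp add: image_constant_conv)
  moreover have "(\<lambda>i\<in>{1..n}. \<mu> (a i)) = (\<lambda>i\<in>{1..n}. ?q)" using a(1) by auto
  \<comment> \<open>Two tuples share all measures \<open>?q\<close>, while their meets have measures
    \<open>?q\<close> and \<open>0\<close>. \<open>F\<close> takes one value on both, so one of its
    errors is at least \<open>?q / 2\<close>.\<close>
  ultimately have errs: "\<bar>?q - F (\<lambda>i\<in>{1..n}. ?q)\<bar> \<le> worst_error \<mu> n F"
    "\<bar>0 - F (\<lambda>i\<in>{1..n}. ?q)\<bar> \<le> worst_error \<mu> n F"
    using error_le_worst_error [OF assms(2), of a] error_le_worst_error [OF assms(2), of "\<lambda>_. b"] a(2) b
    by simp_all
  have half: "q / 2 \<le> w" if "\<bar>q - x\<bar> \<le> w" "\<bar>0 - x\<bar> \<le> w" for q x w :: real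
    using that by linarith
  have "?q / 2 \<le> worst_error \<mu> n F" using errs by (rule half)
  then show ?thesis using assms by (simp add: field_simps)
qed

lemma exists_rule_worst_error_le:
  assumes "n \<ge> 1"
  shows "\<exists>F\<in>rules n. worst_error \<mu> n F \<le> (real n - 1) / (2 * real n)"
proof -
  define F where "F x = (max 0 ((\<Sum>i=1..n. x i) - (real n - 1)) + Min (x ` {1..n})) / 2"
    for x :: "nat \<Rightarrow> real"
  have ne: "{1..n} \<noteq> {}" using assms by simp
  have "F x \<in> {0..1}" if "x \<in> cube n" for x
  proof -
    have x: "0 \<le> x i" "x i \<le> 1" if "i \<in> {1..n}" for i
      using \<open>x \<in> cube n\<close> that by (auto simp: cube_def PiE_iff)
    have "(\<Sum>i=1..n. x i) \<le> real n" using sum_bounded_above [of "{1..n}" x 1] x by simp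
    moreover have "0 \<le> Min (x ` {1..n})" using ne x by simp
    moreover have "Min (x ` {1..n}) \<le> 1"
      using ne x(2) [of 1] assms by (intro order_trans [OF Min_le [of _ "x 1"]]) auto
    ultimately show ?thesis by (simp add: F_def)
  qed
  then have "F \<in> rules n" by (simp add: rules_def)
  moreover have "worst_error \<mu> n F \<le> (real n - 1) / (2 * real n)"
  proof (rule worst_error_le)
    fix a :: "nat \<Rightarrow> 'a"
    let ?m = "\<mu> (\<Sqinter>\<^sub>f\<^sub>i\<^sub>n (a ` {1..n}))"
    define U where "U = Min ((\<lambda>i. \<mu> (a i)) ` {1..n})"
    define L where "L = max 0 ((\<Sum>i=1..n. \<mu> (a i)) - (real n - 1))"
    have F: "F (\<lambda>i\<in>{1..n}. \<mu> (a i)) = (L + U) / 2"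
      by (simp add: F_def L_def U_def cong: image_cong_simp)
    have "L \<le> ?m"
      using measure_Inf_fin_ge [of "{1..n}" a] ne by (simp add: measure_nonneg L_def)
    moreover have "?m \<le> U"
      unfolding U_def using ne by (auto intro: measure_Inf_fin_le)
    \<comment> \<open>Two bounds on the width, \<open>U\<close> and
      \<open>(n - 1) * (1 - U)\<close>, the latter from the sum being at least \<open>n * U\<close>.
      One increases in \<open>U\<close>, the other does not, and both equal
      \<open>(n - 1) / n\<close> at \<open>U = (n - 1) / n\<close>.\<close>
    moreover have "U - L \<le> (real n - 1) / real n"
    proof (cases "U \<le> (real n - 1) / real n")
      case True
      then show ?thesis by (simp add: L_def)
    next
      case False
      have "real n * U \<le> (\<Sum>i=1..n. \<mu> (a i))"
        using sum_bounded_below [of "{1..n}" U "\<lambda>i. \<mu> (a i)"] by (simp add: U_def)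
      then have "U - L \<le> (real n - 1) * (1 - U)" by (simp add: L_def algebra_simps)
      also have "\<dots> \<le> (real n - 1) * (1 - (real n - 1) / real n)"
        using False assms by (intro mult_left_mono) auto
      also have "\<dots> = (real n - 1) / real n" using assms by (simp add: field_simps)
      finally show ?thesis .
    qed
    ultimately have "\<bar>?m - (L + U) / 2\<bar> \<le> (real n - 1) / real n / 2" 
      unfolding abs_le_iff by (intro conjI; argo)
    then show "\<bar>?m - F (\<lambda>i\<in>{1..n}. \<mu> (a i))\<bar> \<le> (real n - 1) / (2 * real n)"
      unfolding F by (simp add: mult.commute)
  qed
  ultimately show ?thesis by blast
qed

lemma minimax_error_eq:
  assumes "n \<ge> 1"
  shows "minimax_error \<mu> n = (real n - 1) / (2 * real n)"
proof (rule antisym)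
  obtain F where F: "F \<in> rules n" "worst_error \<mu> n F \<le> (real n - 1) / (2 * real n)"
    using exists_rule_worst_error_le [OF assms] by blast
  have "bdd_below (worst_error \<mu> n ` rules n)"
    using worst_error_ge [OF assms] by (rule bdd_belowI2)
  then have "minimax_error \<mu> n \<le> worst_error \<mu> n F"
    unfolding minimax_error_def using F(1) by (intro cINF_lower)
  with F(2) show "minimax_error \<mu> n \<le> (real n - 1) / (2 * real n)" by simp
  show "(real n - 1) / (2 * real n) \<le> minimax_error \<mu> n"
    \<comment> \<open>\<open>F(1)\<close> witnesses that \<open>rules n\<close> is nonempty, as the
      greatest-lower-bound rule requires.\<close>
    unfolding minimax_error_def by (rule cINF_greatest) (use F(1) worst_error_ge [OF assms] in auto)
qed

end

section \<open>The equality case and the limits\<close>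

lemma product_critical_eq_half_iff:
  assumes "n \<ge> 2"
  shows "product_critical n = 1 / 2 \<longleftrightarrow> n = 2"
proof
  assume "product_critical n = 1 / 2"
  then have "(1 / 2) ^ (n - 1) = 1 / real n"
    using product_critical_power [OF assms] by (simp only:)
  then have "real n = real (2 ^ (n - 1))"
    using assms by (simp add: power_one_over field_simps)
  then have eq: "n = 2 ^ (n - 1)" by (simp only: of_nat_eq_iff)
  \<comment> \<open>For \<open>n = k + 3\<close> this reads \<open>n < 2^(n - 1)\<close>, which
    excludes every \<open>n\<close> from 3 on.\<close>
  have pow: "k + 3 < 2 ^ (k + 2)" for k :: nat
    by (induction k) auto
  show "n = 2"
  proof (rule ccontr)
    assume "n \<noteq> 2"
    then obtain k where k: "n = k + 3" using assms le_Suc_ex [of 3 n] by (auto simp: add.commute)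
    then have "n < 2 ^ (n - 1)" using pow [of k] by simp
    with eq show False by simp
  qed
next
  assume "n = 2"
  then show "product_critical n = 1 / 2"
    using product_critical_power [of 2] by simp
qed

theorem theorem8:
  fixes \<mu> :: "'a::boolean_algebra \<Rightarrow> real"
  assumes "atomless_measure_algebra \<mu>"
  shows "(\<forall>n\<ge>2. worst_error \<mu> n (product_rule n)
                  = (real n - 1) * real n powr (- (real n / (real n - 1))))
       \<and> (\<forall>n\<ge>2. minimax \<mu> n (product_rule n) \<longleftrightarrow> n = 2)
       \<and> (\<lambda>n. worst_error \<mu> n (product_rule n)) \<longlonglongrightarrow> 1
       \<and> (\<lambda>n. minimax_error \<mu> n) \<longlonglongrightarrow> 1 / 2"
proof (intro conjI allI impI)
  interpret atomless_measure_algebra \<mu> by fact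
  have err: "worst_error \<mu> n (product_rule n)
      = (real n - 1) * real n powr (- (real n / (real n - 1)))" if "n \<ge> 2" for n
    using worst_error_product_rule product_error_eq that by simp
  then show "worst_error \<mu> n (product_rule n)
      = (real n - 1) * real n powr (- (real n / (real n - 1)))" if "n \<ge> 2" for n
    using that .
  show "minimax \<mu> n (product_rule n) \<longleftrightarrow> n = 2" if "n \<ge> 2" for n
  proof -
    \<comment> \<open>Both errors carry the nonzero factor \<open>(n - 1) / n\<close>, so only the
      critical point and \<open>1 / 2\<close> are compared.\<close>
    have "minimax \<mu> n (product_rule n) \<longleftrightarrow>
        (real n - 1) / real n * product_critical n = (real n - 1) / real n * (1 / 2)"
      using that product_rule_in_rules [of n]
      by (simp add: minimax_def worst_error_product_rule minimax_error_eq mult.commute)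
    also have "\<dots> \<longleftrightarrow> product_critical n = 1 / 2"
      unfolding mult_cancel_left using that by simp
    finally have "minimax \<mu> n (product_rule n) \<longleftrightarrow> product_critical n = 1 / 2" .
    then show ?thesis using product_critical_eq_half_iff [OF that] by simp
  qed
  have "(\<lambda>n. (real n - 1) * real n powr (- (real n / (real n - 1)))) \<longlonglongrightarrow> 1"
    by real_asymp
  \<comment> \<open>The closed form is available from \<open>n = 2\<close> on, so the limit is
    transferred along eventual equality.\<close>
  then show "(\<lambda>n. worst_error \<mu> n (product_rule n)) \<longlonglongrightarrow> 1"
    by (rule Lim_transform_eventually)
       (use err in \<open>auto intro!: eventually_sequentiallyI [of 2]\<close>)
  have "(\<lambda>n. (real n - 1) / (2 * real n)) \<longlonglongrightarrow> 1 / 2"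
    by real_asymp
  then show "(\<lambda>n. minimax_error \<mu> n) \<longlonglongrightarrow> 1 / 2"
    by (rule Lim_transform_eventually)
       (use minimax_error_eq in \<open>auto intro!: eventually_sequentiallyI [of 1]\<close>)
qed

end
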